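(* Consider a family (indexed by the linear size $L$) of finite systems with a CA decoder satisfying linear defect erosion, linear message erosion, linear cluster erosion (with constant $\lambda$) and cluster decoupling (with constant $\mu$), with constants independent of $L$. Let the noise be $p$-bounded, let $d_X$ be the minimum diameter of any non-trivial $X$-type logical operator, and assume $d_X=\Omega(L)$ (so that $k_L=\Omega(\log L)$). Then there exist constants $\alpha>0$ and $p_*>0$ such that for $p<p_*$, $$\Pr[\mathsf{Fail}]\le\left(\frac{p}{p_*}\right)^{\Omega(L^\alpha)},$$ where $\mathsf{Fail}$ is the event that decoding produces a non-trivial $X$-type logical error.
   Context: CA decoders. Let $\Lambda=\mathbb Z_L^D$ with $\ell_1$-distance $d$ and closed balls $B_r(\mathbf x)$. Consider a translation-invariant geometrically local CSS code on $\Lambda$; only decoding of $X$-type errors using $Z$-type checks is considered. Each site $\mathbf x$ carries one parity check $s(\mathbf x)$ and qubits $(\mathbf x,j)$, $j\in J=\{1,\dots,n_e\}$; $\Lambda_e=\Lambda\times J$. Each check involves only qubits at sites within distance $d_0>0$ of it. Distances between qubits/checks are distances between their sites. A CA decoder is a translation-invariant synchronous discrete-time cellular automaton of finite interaction range $R$ whose state at each site consists of correction bits $e_1,\dots,e_{n_e}$ (with $e_j(\mathbf x)=1$ iff qubit $(\mathbf x,j)$ has been flipped an odd number of times by the decoder), a syndrome bit $s$, message bits $m_1,\dots,m_{n_m}$, and a clock $c\in\{0,\dots,q-1\}$ that increments modulo $q$ each step, such that: (i) at time $0$ all message, correction and clock channels are zero and the syndrome is that of the initial error configuration; (ii) defect-gated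 flips: there is $d_1>0$ such that $e_j(\mathbf x,t)$ may change at time $t+1$ only if some $\mathbf y$ with $d(\mathbf x,\mathbf y)\le d_1$ has $s(\mathbf y,t)=1$; (iii) the syndrome at every time is the syndrome of the modulo-two sum of the initial error and current correction; (iv) the automaton reads correction bits only for computing the syndrome; (v) trivial (zero) messages remain trivial at any site whose neighborhood has trivial syndromes and messages. Supports of $\mathbf m(t),\mathbf e(t),s(t)$ are the sets of sites where they are non-zero. Linear defect erosion: there is $a\ge1$ such that for all $r\ge1$, $\mathbf x\in\Lambda$, if the initial error is supported in $B_r(\mathbf x)$, then all defects ($s=1$) are eliminated by some time $t\le ar$, and for all $t\ge0$ the correction and syndrome are supported in $B_{ar}(\mathbf x)$. Linear message erosion: there is $b\ge1$ such that for all $t_0$, $r\ge1$, $\mathbf x$, if the syndrome is trivial for all $t\ge t_0$ and $\mathrm{supp}(\mathbf m(t_0))\subseteq B_r(\mathbf x)$, then $\mathrm{supp}(\mathbf m(t))=\varnothing$ for $t\ge t_0+br$ and $\mathrm{supp}(\mathbf m(t))\subseteq B_{br}(\mathbf x)$ for $t\ge t_0$. Linear cluster erosion: there is $\lambda\ge1$ such that for all $r\ge1$, $\mathbf x$ and initial errors supported in $B_r(\mathbf x)$: the spacetime region where syndrome or messages are non-trivial is contained in $B_{\lambda r}(\mathbf x)\times[0,\lambda r]$, and the correction is supported in $B_{\lambda r}(\mathbf x)$ for all $t$ and constant for $t\ge\lambda r$. Net correction of a trajectory $\zeta$: $\Delta\zeta=\lim_{t\to\infty}\mathbf e(t)\in\mathbb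 F_2^{\Lambda_e}$. Cluster decoupling: there is $\mu\ge1$ such that for all $r\ge1$, $\mathbf x$ and finite initial errors with no error in $B_{\mu r}(\mathbf x)\setminus B_r(\mathbf x)$, $\Delta\zeta=\Delta\zeta^{\rm in}+\Delta\zeta^{\rm out}$, where $\zeta,\zeta^{\rm in},\zeta^{\rm out}$ are the trajectories started from the full error configuration, its restriction to $B_r(\mathbf x)$, and its restriction to $\Lambda\setminus B_{\mu r}(\mathbf x)$. Convention: these erosion properties are assumed to hold for all initial error configurations of the finite system. Noise. A noise realization $N$ is a random subset of $\Lambda_e$; it is $p$-bounded if $\Pr[A\subseteq N]\le p^{|A|}$ for all finite $A\subset\Lambda_e$. Scales. Fix constants $\beta,\gamma>0$ and a positive integer $n$ with $\frac{2\gamma}{1-1/n}<\beta<\gamma n$; set $w_k=w_0n^k$, $b_k=b_0n^k$ with $w_0=2\beta$, $b_0=\gamma n-\beta$; assume $b_k\ge(1+\mu)w_k$ for all $k$ and $w_0\ge1$. $k_L$ is the largest non-negative integer such that $2\lambda w_k<d_X$ for all $k<k_L$. $\mathsf{Fail}$: the residual error $\Delta\zeta+N$ is not an $X$-type stabilizer. A known result (sparsity theorem) that may be assumed: let $N_0=N$ and let $N_{k+1}$ be obtained from $N_k$ by deleting every subset of $N_k$ of diameter at most $w_k$ at distance more than $b_k$ from the rest of $N_k$; then there are $p_*,C>0$ depending only on $D,\beta,\gamma,n,|J|$ with $\max_{x\in\Lambda_e}\Pr[x\in N_k]\le C(p/p_* )^{2^k}$ for all $k$ and $L$. *)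

theory Defs
  imports "HOL-Probability.Probability"
begin

section \<open>The torus\<close>

text \<open>The dimension \<open>D\<close> is the cardinality of the finite index type \<open>'d\<close>.  Coordinates of sites are
  canonical representatives modulo \<open>L\<close>.\<close>

type_synonym 'd site = "'d \<Rightarrow> int"

definition sites :: "nat \<Rightarrow> 'd::finite site set" where
  "sites L = {x. \<forall>i. 0 \<le> x i \<and> x i < int L}"

definition tadd :: "nat \<Rightarrow> 'd::finite site \<Rightarrow> ('d \<Rightarrow> int) \<Rightarrow> 'd site" where
  "tadd L x v = (\<lambda>i. (x i + v i) mod int L)"

definition tdist :: "nat \<Rightarrow> 'd::finite site \<Rightarrow> 'd site \<Rightarrow> nat" where
  "tdist L x y = (\<Sum>i\<in>UNIV. nat (min ((x i - y i) mod int L) ((y i - x i) mod int L)))"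

definition tball :: "nat \<Rightarrow> real \<Rightarrow> 'd::finite site \<Rightarrow> 'd site set" where
  "tball L r x = {y \<in> sites L. real (tdist L x y) \<le> r}"


section \<open>CSS codes\<close>

text \<open>Vectors over the two-element field indexed by qubits (errors, corrections, operators of type
  \<open>X\<close>) are identified with their supports; addition is symmetric difference.\<close>

type_synonym 'd qubit = "'d site \<times> nat"

definition qubits :: "nat \<Rightarrow> nat \<Rightarrow> 'd::finite qubit set" where
  "qubits L ne = sites L \<times> {1..ne}"

definition qshift :: "nat \<Rightarrow> ('d \<Rightarrow> int) \<Rightarrow> 'd::finite qubit \<Rightarrow> 'd qubit" where
  "qshift L v = (\<lambda>(x, j). (tadd L x v, j))"

text \<open>\<open>zchk C x\<close> is the support of the \<open>Z\<close>-type check at \<open>x\<close>, and \<open>xchk C x i\<close>, for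
  \<open>i \<in> {1..nx}\<close>, are the supports of the \<open>X\<close>-type checks at \<open>x\<close>.\<close>

record 'd code =
  zchk :: "'d site \<Rightarrow> 'd qubit set"
  xchk :: "'d site \<Rightarrow> nat \<Rightarrow> 'd qubit set"

definition local_css_code :: "nat \<Rightarrow> nat \<Rightarrow> nat \<Rightarrow> real \<Rightarrow> 'd::finite code \<Rightarrow> bool" where
  "local_css_code L ne nx d0 C \<longleftrightarrow>
     (\<forall>x\<in>sites L. zchk C x \<subseteq> tball L d0 x \<times> {1..ne}) \<and>
     (\<forall>x\<in>sites L. \<forall>i\<in>{1..nx}. xchk C x i \<subseteq> tball L d0 x \<times> {1..ne}) \<and>
     (\<forall>x\<in>sites L. \<forall>v. zchk C (tadd L x v) = qshift L v ` zchk C x) \<and>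
     (\<forall>x\<in>sites L. \<forall>v. \<forall>i\<in>{1..nx}. xchk C (tadd L x v) i = qshift L v ` xchk C x i) \<and>
     (\<forall>x\<in>sites L. \<forall>y\<in>sites L. \<forall>i\<in>{1..nx}. even (card (zchk C x \<inter> xchk C y i)))"

definition syndrome :: "'d::finite code \<Rightarrow> 'd qubit set \<Rightarrow> 'd site \<Rightarrow> bool" where
  "syndrome C E x \<longleftrightarrow> odd (card (E \<inter> zchk C x))"

inductive_set x_stabilizers :: "nat \<Rightarrow> nat \<Rightarrow> 'd::finite code \<Rightarrow> 'd qubit set set"
  for L :: nat and nx :: nat and C :: "'d code" where
  identity: "{} \<in> x_stabilizers L nx C"
| mult: "S \<in> x_stabilizers L nx C \<Longrightarrow> x \<in> sites L \<Longrightarrow> i \<in> {1..nx} \<Longrightarrow>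
     sym_diff S (xchk C x i) \<in> x_stabilizers L nx C"

definition nontrivial_x_logical ::
    "nat \<Rightarrow> nat \<Rightarrow> nat \<Rightarrow> 'd::finite code \<Rightarrow> 'd qubit set \<Rightarrow> bool" where
  "nontrivial_x_logical L ne nx C E \<longleftrightarrow>
     E \<subseteq> qubits L ne \<and> (\<forall>x\<in>sites L. \<not> syndrome C E x) \<and> E \<notin> x_stabilizers L nx C"

definition qdiam :: "nat \<Rightarrow> 'd::finite qubit set \<Rightarrow> nat" where
  "qdiam L E = (SUP (u, v)\<in>E \<times> E. tdist L (fst u) (fst v))"

text \<open>The value is \<open>\<infinity>\<close> exactly if there is no non-trivial \<open>X\<close>-type logical operator.\<close>

definition x_distance :: "nat \<Rightarrow> nat \<Rightarrow> nat \<Rightarrow> 'd::finite code \<Rightarrow> ereal" where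
  "x_distance L ne nx C =
     (INF E\<in>{E. nontrivial_x_logical L ne nx C E}. ereal (real (qdiam L E)))"


section \<open>Cellular automaton decoders\<close>

text \<open>\<open>corr\<close> and \<open>msg\<close> are the sets of indices whose correction, respectively message, bit is one.\<close>

record cell =
  corr :: "nat set"
  synd :: bool
  msg :: "nat set"
  clk :: nat

type_synonym 'd config = "'d site \<Rightarrow> cell"

definition configs :: "nat \<Rightarrow> nat \<Rightarrow> nat \<Rightarrow> nat \<Rightarrow> 'd::finite config set" where
  "configs L ne nm q =
     {\<eta>. \<forall>x\<in>sites L. corr (\<eta> x) \<subseteq> {1..ne} \<and> msg (\<eta> x) \<subseteq> {1..nm} \<and> clk (\<eta> x) < q}"

text \<open>An automaton is given by its global update map.  The values of configurations outside
  \<open>sites L\<close> are irrelevant, because balls are contained in \<open>sites L\<close>.\<close>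

definition cellular_automaton ::
    "nat \<Rightarrow> nat \<Rightarrow> nat \<Rightarrow> nat \<Rightarrow> real \<Rightarrow> ('d::finite config \<Rightarrow> 'd config) \<Rightarrow> bool" where
  "cellular_automaton L ne nm q R F \<longleftrightarrow>
     (\<forall>\<eta>\<in>configs L ne nm q. F \<eta> \<in> configs L ne nm q) \<and>
     (\<forall>\<eta>\<in>configs L ne nm q. \<forall>\<eta>'\<in>configs L ne nm q. \<forall>x\<in>sites L.
        (\<forall>y\<in>tball L R x. \<eta> y = \<eta>' y) \<longrightarrow> F \<eta> x = F \<eta>' x) \<and>
     (\<forall>\<eta>\<in>configs L ne nm q. \<forall>v. \<forall>x\<in>sites L.
        F (\<lambda>y. \<eta> (tadd L y v)) x = F \<eta> (tadd L x v))"

definition initial_config :: "'d::finite code \<Rightarrow> 'd qubit set \<Rightarrow> 'd config" where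
  "initial_config C E = (\<lambda>x. \<lparr>corr = {}, synd = syndrome C E x, msg = {}, clk = 0\<rparr>)"

definition trajectory ::
    "'d::finite code \<Rightarrow> ('d config \<Rightarrow> 'd config) \<Rightarrow> 'd qubit set \<Rightarrow> nat \<Rightarrow> 'd config" where
  "trajectory C F E t = (F ^^ t) (initial_config C E)"

definition correction :: "nat \<Rightarrow> 'd::finite config \<Rightarrow> 'd qubit set" where
  "correction L \<eta> = {(x, j). x \<in> sites L \<and> j \<in> corr (\<eta> x)}"

definition supp_corr :: "nat \<Rightarrow> 'd::finite config \<Rightarrow> 'd site set" where
  "supp_corr L \<eta> = {x \<in> sites L. corr (\<eta> x) \<noteq> {}}"

definition supp_synd :: "nat \<Rightarrow> 'd::finite config \<Rightarrow> 'd site set" where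
  "supp_synd L \<eta> = {x \<in> sites L. synd (\<eta> x)}"

definition supp_msg :: "nat \<Rightarrow> 'd::finite config \<Rightarrow> 'd site set" where
  "supp_msg L \<eta> = {x \<in> sites L. msg (\<eta> x) \<noteq> {}}"

text \<open>In order: the clock; defect-gated flips; consistency of the syndrome; flips and new messages
  do not depend on the correction bits (only the new syndrome bit may); trivial messages stay trivial
  where the neighbourhood is trivial.  The initial condition is part of \<^const>\<open>trajectory\<close>.\<close>

definition ca_decoder ::
    "nat \<Rightarrow> nat \<Rightarrow> nat \<Rightarrow> nat \<Rightarrow> real \<Rightarrow> real \<Rightarrow> 'd::finite code \<Rightarrow> ('d config \<Rightarrow> 'd config) \<Rightarrow> bool"
  where
  "ca_decoder L ne nm q R d1 C F \<longleftrightarrow>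
     cellular_automaton L ne nm q R F \<and>
     (\<forall>\<eta>\<in>configs L ne nm q. \<forall>x\<in>sites L. clk (F \<eta> x) = (clk (\<eta> x) + 1) mod q) \<and>
     (\<forall>E\<subseteq>qubits L ne. \<forall>t. \<forall>x\<in>sites L.
        corr (trajectory C F E (Suc t) x) \<noteq> corr (trajectory C F E t x) \<longrightarrow>
        (\<exists>y\<in>tball L d1 x. synd (trajectory C F E t y))) \<and>
     (\<forall>E\<subseteq>qubits L ne. \<forall>t. \<forall>x\<in>sites L.
        synd (trajectory C F E t x) =
        syndrome C (sym_diff E (correction L (trajectory C F E t))) x) \<and>
     (\<forall>\<eta>\<in>configs L ne nm q. \<forall>\<eta>'\<in>configs L ne nm q. \<forall>x\<in>sites L.
        (\<forall>y\<in>tball L R x.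
           synd (\<eta> y) = synd (\<eta>' y) \<and> msg (\<eta> y) = msg (\<eta>' y) \<and> clk (\<eta> y) = clk (\<eta>' y)) \<longrightarrow>
        sym_diff (corr (F \<eta> x)) (corr (\<eta> x)) = sym_diff (corr (F \<eta>' x)) (corr (\<eta>' x)) \<and>
        msg (F \<eta> x) = msg (F \<eta>' x)) \<and>
     (\<forall>\<eta>\<in>configs L ne nm q. \<forall>x\<in>sites L.
        (\<forall>y\<in>tball L R x. \<not> synd (\<eta> y) \<and> msg (\<eta> y) = {}) \<longrightarrow> msg (F \<eta> x) = {})"

definition linear_defect_erosion ::
    "nat \<Rightarrow> nat \<Rightarrow> real \<Rightarrow> 'd::finite code \<Rightarrow> ('d config \<Rightarrow> 'd config) \<Rightarrow> bool" where
  "linear_defect_erosion L ne a C F \<longleftrightarrow>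
     (\<forall>r\<ge>1. \<forall>x\<in>sites L. \<forall>E \<subseteq> tball L r x \<times> {1..ne}.
        (\<exists>t. real t \<le> a * r \<and> (\<forall>t'\<ge>t. supp_synd L (trajectory C F E t') = {})) \<and>
        (\<forall>t. supp_corr L (trajectory C F E t) \<subseteq> tball L (a * r) x \<and>
             supp_synd L (trajectory C F E t) \<subseteq> tball L (a * r) x))"

definition linear_message_erosion ::
    "nat \<Rightarrow> nat \<Rightarrow> real \<Rightarrow> 'd::finite code \<Rightarrow> ('d config \<Rightarrow> 'd config) \<Rightarrow> bool" where
  "linear_message_erosion L ne b C F \<longleftrightarrow>
     (\<forall>E \<subseteq> qubits L ne. \<forall>t\<^sub>0. \<forall>r\<ge>1. \<forall>x\<in>sites L.
        (\<forall>t\<ge>t\<^sub>0. supp_synd L (trajectory C F E t) = {}) \<and>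
        supp_msg L (trajectory C F E t\<^sub>0) \<subseteq> tball L r x \<longrightarrow>
        (\<forall>t. real t \<ge> real t\<^sub>0 + b * r \<longrightarrow> supp_msg L (trajectory C F E t) = {}) \<and>
        (\<forall>t\<ge>t\<^sub>0. supp_msg L (trajectory C F E t) \<subseteq> tball L (b * r) x))"

definition linear_cluster_erosion ::
    "nat \<Rightarrow> nat \<Rightarrow> real \<Rightarrow> 'd::finite code \<Rightarrow> ('d config \<Rightarrow> 'd config) \<Rightarrow> bool" where
  "linear_cluster_erosion L ne lam C F \<longleftrightarrow>
     (\<forall>r\<ge>1. \<forall>x\<in>sites L. \<forall>E \<subseteq> tball L r x \<times> {1..ne}.
        (\<forall>t. \<forall>y \<in> supp_synd L (trajectory C F E t) \<union> supp_msg L (trajectory C F E t).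
           y \<in> tball L (lam * r) x \<and> real t \<le> lam * r) \<and>
        (\<forall>t. supp_corr L (trajectory C F E t) \<subseteq> tball L (lam * r) x) \<and>
        (\<forall>t t'. real t \<ge> lam * r \<and> real t' \<ge> lam * r \<longrightarrow>
           correction L (trajectory C F E t) = correction L (trajectory C F E t')))"

text \<open>The limit is taken in the discrete space of corrections, so it is the eventual value.\<close>

definition net_correction ::
    "nat \<Rightarrow> 'd::finite code \<Rightarrow> ('d config \<Rightarrow> 'd config) \<Rightarrow> 'd qubit set \<Rightarrow> 'd qubit set" where
  "net_correction L C F E =
     (THE A. \<forall>\<^sub>F t in sequentially. correction L (trajectory C F E t) = A)"

definition cluster_decoupling ::
    "nat \<Rightarrow> nat \<Rightarrow> real \<Rightarrow> 'd::finite code \<Rightarrow> ('d config \<Rightarrow> 'd config) \<Rightarrow> bool" where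
  "cluster_decoupling L ne mu C F \<longleftrightarrow>
     (\<forall>r\<ge>1. \<forall>x\<in>sites L. \<forall>E \<subseteq> qubits L ne.
        E \<inter> (tball L (mu * r) x - tball L r x) \<times> UNIV = {} \<longrightarrow>
        net_correction L C F E =
        sym_diff (net_correction L C F (E \<inter> tball L r x \<times> UNIV))
                 (net_correction L C F (E - tball L (mu * r) x \<times> UNIV)))"

definition decoding_fails ::
    "nat \<Rightarrow> nat \<Rightarrow> 'd::finite code \<Rightarrow> ('d config \<Rightarrow> 'd config) \<Rightarrow> 'd qubit set \<Rightarrow> bool" where
  "decoding_fails L nx C F E \<longleftrightarrow> sym_diff (net_correction L C F E) E \<notin> x_stabilizers L nx C"


section \<open>Noise and scales\<close>

text \<open>A random subset of the finite set of qubits is given by its distribution.\<close>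

definition p_bounded_noise :: "nat \<Rightarrow> nat \<Rightarrow> real \<Rightarrow> 'd::finite qubit set pmf \<Rightarrow> bool" where
  "p_bounded_noise L ne p \<nu> \<longleftrightarrow>
     set_pmf \<nu> \<subseteq> Pow (qubits L ne) \<and>
     (\<forall>A \<subseteq> qubits L ne. measure_pmf.prob \<nu> {N. A \<subseteq> N} \<le> p ^ card A)"

definition scale_w :: "real \<Rightarrow> nat \<Rightarrow> nat \<Rightarrow> real" where
  "scale_w \<beta> n k = 2 * \<beta> * real n ^ k"

definition scale_b :: "real \<Rightarrow> real \<Rightarrow> nat \<Rightarrow> nat \<Rightarrow> real" where
  "scale_b \<beta> \<gamma> n k = (\<gamma> * real n - \<beta>) * real n ^ k"

text \<open>The condition \<open>n \<ge> 2\<close> excludes the division by zero at \<open>n = 1\<close>.\<close>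

definition admissible_scales :: "real \<Rightarrow> real \<Rightarrow> nat \<Rightarrow> real \<Rightarrow> bool" where
  "admissible_scales \<beta> \<gamma> n mu \<longleftrightarrow>
     \<beta> > 0 \<and> \<gamma> > 0 \<and> n \<ge> 2 \<and>
     2 * \<gamma> / (1 - 1 / real n) < \<beta> \<and> \<beta> < \<gamma> * real n \<and>
     (\<forall>k. scale_b \<beta> \<gamma> n k \<ge> (1 + mu) * scale_w \<beta> n k) \<and>
     scale_w \<beta> n 0 \<ge> 1"

text \<open>The set below is downward closed, so its supremum is its largest element if the distance
  \<open>dX\<close> is finite, and \<open>\<infinity>\<close> if \<open>dX = \<infinity>\<close>.\<close>

definition max_scale :: "real \<Rightarrow> nat \<Rightarrow> real \<Rightarrow> ereal \<Rightarrow> enat" where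
  "max_scale \<beta> n lam dX = Sup {enat K |K. \<forall>k<K. ereal (2 * lam * scale_w \<beta> n k) < dX}"

end

theory Submission
  imports Defs "HOL-Real_Asymp.Real_Asymp"
begin

text \<open>Errors that are isolated at scale \<open>w\<^sub>k\<close> are removed level by level.  By cluster decoupling each
  removed cluster contributes its own residual error, which by cluster erosion has trivial syndrome
  and diameter below the code distance, hence is a stabilizer.  So decoding can only fail if some
  error survives \<open>K\<close> levels, where \<open>K\<close> is of order \<open>ln L\<close>.  A survivor is the root of a binary tree of
  \<open>2 ^ K\<close> distinct errors; there are at most \<open>Q ^ 2 ^ K\<close> such trees per root, and a union bound
  gives failure probability at most \<open>O(L ^ D) (Q p) ^ 2 ^ K\<close>, where \<open>2 ^ K\<close> is a power of \<open>L\<close>.\<close>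

section \<open>Geometry of the torus\<close>

lemma min_mod_le_abs:
  fixes l a :: int
  assumes "l > 0"
  shows "min (a mod l) (- a mod l) \<le> \<bar>a\<bar>"
  using zmod_le_nonneg_dividend[of a l] zmod_le_nonneg_dividend[of "- a" l] by linarith

text \<open>Turns the cyclic distance of one coordinate into the absolute value of an integer, so
  that the triangle inequality and the counting of balls reduce to the integers.\<close>

lemma min_mod_representative:
  fixes l a :: int
  assumes "l > 0"
  obtains a' where "a' mod l = a mod l" "\<bar>a'\<bar> = min (a mod l) (- a mod l)"
proof (cases "a mod l \<le> - a mod l")
  case True
  then show ?thesis using that[of "a mod l"] assms by simp
next
  case False
  have "(- (- a mod l)) mod l = a mod l" by (simp add: mod_minus_eq)
  then show ?thesis using that[of "- (- a mod l)"] False assms by simp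
qed

lemma min_mod_triangle:
  fixes l a c :: int
  assumes "l > 0"
  shows "min ((a + c) mod l) (- (a + c) mod l) \<le>
    min (a mod l) (- a mod l) + min (c mod l) (- c mod l)"
proof -
  obtain a' where a': "a' mod l = a mod l" "\<bar>a'\<bar> = min (a mod l) (- a mod l)"
    using min_mod_representative[OF assms] by blast
  obtain c' where c': "c' mod l = c mod l" "\<bar>c'\<bar> = min (c mod l) (- c mod l)"
    using min_mod_representative[OF assms] by blast
  have eq: "(a' + c') mod l = (a + c) mod l"
    by (rule mod_add_cong[OF a'(1) c'(1)])
  then have "(- (a' + c')) mod l = (- (a + c)) mod l"
    by (rule mod_minus_cong)
  with eq min_mod_le_abs[OF assms, of "a' + c'"]
  have "min ((a + c) mod l) (- (a + c) mod l) \<le> \<bar>a' + c'\<bar>" by simp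
  with a'(2) c'(2) show ?thesis by linarith
qed

lemma tdist_refl [simp]: "tdist L x x = 0"
  by (simp add: tdist_def)

lemma tdist_commute: "tdist L x y = tdist L y x"
  by (simp add: tdist_def min.commute)

lemma tdist_triangle:
  assumes "L \<ge> 1"
  shows "tdist L x z \<le> tdist L x y + tdist L y z"
proof -
  let ?m = "\<lambda>a. min (a mod int L) (- a mod int L)"
  have "nat (?m (x i - z i)) \<le> nat (?m (x i - y i)) + nat (?m (y i - z i))" for i
    using min_mod_triangle[of "int L" "x i - y i" "y i - z i"] assms by simp
  then have "(\<Sum>i\<in>UNIV. nat (?m (x i - z i))) \<le>
      (\<Sum>i\<in>UNIV. nat (?m (x i - y i)) + nat (?m (y i - z i)))"
    by (intro sum_mono)
  then show ?thesis by (simp add: tdist_def sum.distrib)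
qed

text \<open>A site of the ball is \<open>x\<close> shifted by an integer vector with all coordinates
  between \<open>-r\<close> and \<open>r\<close>, because a single coordinate contributes at most
  the whole distance. The cube of such vectors may wrap around the torus, which only lowers the
  count.\<close>

lemma card_tball:
  fixes x :: "'d::finite site"
  assumes L: "L \<ge> 1" and r: "r \<ge> 0"
  shows "finite (tball L r x)" "real (card (tball L r x)) \<le> (2 * r + 1) ^ CARD('d)"
proof -
  define S where "S = {- \<lfloor>r\<rfloor>..\<lfloor>r\<rfloor>}"
  have sub: "tball L r x \<subseteq> tadd L x ` PiE UNIV (\<lambda>_. S)"
  proof
    fix y assume "y \<in> tball L r x"
    then have y: "y \<in> sites L" "real (tdist L x y) \<le> r" by (auto simp: tball_def)
    have "\<exists>v. v mod int L = (y i - x i) mod int L \<and>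
        \<bar>v\<bar> = min ((y i - x i) mod int L) (- (y i - x i) mod int L)" for i
      using min_mod_representative[of "int L" "y i - x i"] L by auto
    then obtain v where v: "\<And>i. v i mod int L = (y i - x i) mod int L"
        "\<And>i. \<bar>v i\<bar> = min ((y i - x i) mod int L) (- (y i - x i) mod int L)"
      by metis
    have "v i \<in> S" for i
    proof -
      have "nat \<bar>v i\<bar> \<le> tdist L x y"
        unfolding tdist_def v(2) by (subst min.commute) (simp, rule member_le_sum, auto)
      then have "real_of_int \<bar>v i\<bar> \<le> r" using y(2) by linarith
      then have "\<bar>v i\<bar> \<le> \<lfloor>r\<rfloor>" by (simp add: le_floor_iff)
      then show ?thesis by (auto simp: S_def)
    qed
    moreover have "y = tadd L x v"
    proof
      fix i
      have "(x i + v i) mod int L = (x i + (y i - x i)) mod int L"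
        using v(1) by (rule mod_add_cong[OF refl])
      then show "y i = tadd L x v i" using y(1) by (simp add: tadd_def sites_def)
    qed
    ultimately show "y \<in> tadd L x ` PiE UNIV (\<lambda>_. S)" by auto
  qed
  have fin: "finite (PiE (UNIV :: 'd set) (\<lambda>_. S))"
    by (rule finite_PiE) (auto simp: S_def)
  show "finite (tball L r x)" using sub fin by (meson finite_imageI finite_subset)
  have "card (tball L r x) \<le> card (PiE (UNIV :: 'd set) (\<lambda>_. S))"
    using sub fin by (meson card_image_le card_mono finite_imageI order_trans)
  also have "\<dots> = card S ^ CARD('d)" by (simp add: card_PiE)
  finally have "real (card (tball L r x)) \<le> real (card S) ^ CARD('d)"
    by (metis of_nat_le_iff of_nat_power)
  also have "\<dots> \<le> (2 * r + 1) ^ CARD('d)"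
  proof (rule power_mono)
    have "real (card S) = 2 * of_int \<lfloor>r\<rfloor> + 1" using r by (simp add: S_def)
    also have "\<dots> \<le> 2 * r + 1" by linarith
    finally show "real (card S) \<le> 2 * r + 1" .
  qed simp
  finally show "real (card (tball L r x)) \<le> (2 * r + 1) ^ CARD('d)" .
qed

lemma card_sites: "finite (sites L :: 'd::finite site set)"
  "card (sites L :: 'd site set) = L ^ CARD('d)"
proof -
  have eq: "(sites L :: 'd site set) = PiE UNIV (\<lambda>_. {0..<int L})"
    by (auto simp: sites_def PiE_def Pi_def)
  show "finite (sites L :: 'd site set)" unfolding eq by (rule finite_PiE) auto
  show "card (sites L :: 'd site set) = L ^ CARD('d)" unfolding eq by (simp add: card_PiE)
qed

lemma finite_qubits: "finite (qubits L ne)"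
  by (simp add: qubits_def card_sites)

lemma card_qubits: "card (qubits L ne :: 'd::finite qubit set) = L ^ CARD('d) * ne"
  by (simp add: qubits_def card_cartesian_product card_sites)

lemma tball_subset_sites: "tball L r x \<subseteq> sites L"
  by (auto simp: tball_def)


section \<open>Stabilizers and small clusters\<close>

lemma x_stabilizers_sym_diff:
  assumes "S \<in> x_stabilizers L nx C" "T \<in> x_stabilizers L nx C"
  shows "sym_diff S T \<in> x_stabilizers L nx C"
  using assms(2)
proof induction
  case identity
  then show ?case using assms(1) by simp
next
  case (mult T x i)
  have "sym_diff S (sym_diff T (xchk C x i)) = sym_diff (sym_diff S T) (xchk C x i)" by auto
  with mult show ?case using x_stabilizers.mult by metis
qed

text \<open>Two qubits of \<open>E\<close> are compared through the center, so the diameter is at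
  most \<open>2 * r\<close>, less than that of any non-trivial logical operator.\<close>

lemma x_stabilizer_if_small:
  assumes L: "L \<ge> 1" and x: "x \<in> sites L"
    and E: "E \<subseteq> tball L r x \<times> {1..ne}"
    and syn: "\<forall>y\<in>sites L. \<not> syndrome C E y"
    and dist: "ereal (2 * r) < x_distance L ne nx C" and r: "r \<ge> 0"
  shows "E \<in> x_stabilizers L nx C"
proof (rule ccontr)
  assume "E \<notin> x_stabilizers L nx C"
  moreover have "E \<subseteq> qubits L ne"
    using E tball_subset_sites[of L r x] by (auto simp: qubits_def)
  ultimately have "nontrivial_x_logical L ne nx C E"
    using syn by (simp add: nontrivial_x_logical_def)
  then have "x_distance L ne nx C \<le> ereal (real (qdiam L E))"
    unfolding x_distance_def by (intro INF_lower) simp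
  also have "real (qdiam L E) \<le> 2 * r"
  \<comment> \<open>For the empty set \<open>qdiam\<close> is the supremum of no natural numbers,
    which is 0; \<open>cSUP_least\<close> needs a non-empty index set.\<close>
  proof (cases "E = {}")
    case True
    then show ?thesis using r by (simp add: qdiam_def)
  next
    case False
    have "tdist L (fst u) (fst v) \<le> nat \<lfloor>2 * r\<rfloor>" if "u \<in> E" "v \<in> E" for u v
    proof -
      have "real (tdist L x (fst u)) \<le> r" "real (tdist L x (fst v)) \<le> r"
        using that E by (auto simp: tball_def)
      moreover have "real (tdist L (fst u) (fst v)) \<le>
          real (tdist L x (fst u)) + real (tdist L x (fst v))"
        using tdist_triangle[OF L, of "fst u" "fst v" x] by (simp add: tdist_commute)
      ultimately show ?thesis by (simp add: le_nat_floor)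
    qed
    then have "qdiam L E \<le> nat \<lfloor>2 * r\<rfloor>"
      unfolding qdiam_def using False by (intro cSUP_least) auto
    then show ?thesis using r by linarith
  qed
  finally show False using dist by (simp add: not_less[symmetric])
qed

lemma net_correction_eqI:
  assumes "\<And>t. t \<ge> t0 \<Longrightarrow> correction L (trajectory C F E t) = A"
  shows "net_correction L C F E = A"
  unfolding net_correction_def
proof (rule the_equality)
  show ev: "\<forall>\<^sub>F t in sequentially. correction L (trajectory C F E t) = A"
    using assms by (auto simp: eventually_sequentially)
  fix B assume "\<forall>\<^sub>F t in sequentially. correction L (trajectory C F E t) = B"
  with ev have "\<forall>\<^sub>F t :: nat in sequentially. B = A" by eventually_elim simp
  then show "B = A" by simp
qed

text \<open>Once the defects are gone, consistency of the syndrome makes the residual error commute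
  with all checks. Error and correction both lie in the ball of radius \<open>lam * r\<close>, so
  the residual error is too small to be a non-trivial logical operator.\<close>

lemma small_cluster_corrected:
  fixes C :: "'d::finite code"
  assumes L: "L \<ge> 1" and lam: "lam \<ge> 1" and r: "r \<ge> 1" and x: "x \<in> sites L"
    and E: "E \<subseteq> tball L r x \<times> {1..ne}"
    and dec: "ca_decoder L ne nm q R d1 C F" and q: "q \<ge> 1"
    and ero: "linear_cluster_erosion L ne lam C F"
    and dist: "ereal (2 * lam * r) < x_distance L ne nx C"
  shows "\<not> decoding_fails L nx C F E"
proof -
  \<comment> \<open>Cluster erosion still allows defects at time exactly \<open>lam * r\<close>;
    adding 1 makes \<open>T\<close> strictly later.\<close>
  define T where "T = nat \<lceil>lam * r\<rceil> + 1"
  have T: "real t > lam * r" if "t \<ge> T" for t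
    using that unfolding T_def by linarith
  have Eq: "E \<subseteq> qubits L ne"
    using E tball_subset_sites[of L r x] by (auto simp: qubits_def)
  have quiet: "\<forall>t. \<forall>y \<in> supp_synd L (trajectory C F E t) \<union> supp_msg L (trajectory C F E t).
        y \<in> tball L (lam * r) x \<and> real t \<le> lam * r"
    and supp: "supp_corr L (trajectory C F E t) \<subseteq> tball L (lam * r) x"
    and const: "\<And>t t'. real t \<ge> lam * r \<Longrightarrow> real t' \<ge> lam * r \<Longrightarrow>
        correction L (trajectory C F E t) = correction L (trajectory C F E t')" for t
    using ero[unfolded linear_cluster_erosion_def, rule_format, OF r x E] by blast+
  define A where "A = correction L (trajectory C F E T)"
  have net: "net_correction L C F E = A"
    unfolding A_def by (rule net_correction_eqI[of T]) (meson T const le_refl less_imp_le)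
  \<comment> \<open>Membership in \<open>configs\<close> keeps the correction indices in
    \<open>{1..ne}\<close>, so that \<open>A\<close> consists of qubits.\<close>
  have conf: "trajectory C F E t \<in> configs L ne nm q" for t
  proof (induction t)
    case 0
    then show ?case using q by (auto simp: trajectory_def initial_config_def configs_def)
  next
    case (Suc t)
    then show ?case using dec
      by (auto simp: trajectory_def ca_decoder_def cellular_automaton_def)
  qed
  have "A \<subseteq> tball L (lam * r) x \<times> {1..ne}"
    using supp[of T] conf[of T]
    by (auto simp: A_def correction_def supp_corr_def configs_def)
  moreover have "r \<le> lam * r" using lam r by simp
  then have "tball L r x \<subseteq> tball L (lam * r) x" by (auto simp: tball_def)
  ultimately have sub: "sym_diff A E \<subseteq> tball L (lam * r) x \<times> {1..ne}" using E by blast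
  have "\<not> syndrome C (sym_diff A E) y" if y: "y \<in> sites L" for y
  proof -
    have "lam * r < real T" using T by simp
    then have "y \<notin> supp_synd L (trajectory C F E T)" using quiet by (meson UnI1 not_le)
    then have "\<not> synd (trajectory C F E T y)" using y by (simp add: supp_synd_def)
    moreover have "\<forall>E\<subseteq>qubits L ne. \<forall>t. \<forall>x\<in>sites L. synd (trajectory C F E t x) =
        syndrome C (sym_diff E (correction L (trajectory C F E t))) x"
      using dec unfolding ca_decoder_def by (elim conjE)
    then have "synd (trajectory C F E T y) = syndrome C (sym_diff E A) y"
      using Eq y unfolding A_def by blast
    ultimately show ?thesis by (simp add: Un_commute)
  qed
  then have "sym_diff A E \<in> x_stabilizers L nx C"
    using x_stabilizer_if_small[OF L x sub, of C nx] dist lam r by (simp add: mult.assoc)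
  then show ?thesis by (simp add: decoding_fails_def net)
qed

text \<open>The centers need not be errors, so clusters can be removed one at a time even if their balls
  overlap.\<close>

lemma remove_clusters:
  fixes C :: "'d::finite code"
  assumes L: "L \<ge> 1" and lam: "lam \<ge> 1" and mu: "mu \<ge> 1" and r: "r \<ge> 1"
    and dec: "ca_decoder L ne nm q R d1 C F" and q: "q \<ge> 1"
    and ero: "linear_cluster_erosion L ne lam C F"
    and dcp: "cluster_decoupling L ne mu C F"
    and dist: "ereal (2 * lam * r) < x_distance L ne nx C"
    and U: "finite U" "U \<subseteq> sites L" and E: "E \<subseteq> qubits L ne"
    and sep: "\<And>x. x \<in> U \<Longrightarrow> E \<inter> (tball L (mu * r) x - tball L r x) \<times> UNIV = {}"
    and ok: "\<not> decoding_fails L nx C F (E - (\<Union>x\<in>U. tball L r x) \<times> UNIV)"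
  shows "\<not> decoding_fails L nx C F E"
  using U E sep ok
proof (induction U arbitrary: E)
  case empty
  then show ?case by simp
next
  case (insert x U)
  let ?E1 = "E \<inter> tball L r x \<times> UNIV" and ?E2 = "E - tball L (mu * r) x \<times> UNIV"
  have x: "x \<in> sites L" and EQ: "E \<subseteq> qubits L ne" using insert.prems by auto
  have sepx: "E \<inter> (tball L (mu * r) x - tball L r x) \<times> UNIV = {}"
    using insert.prems(3) by blast
  have "r \<le> mu * r" using mu r by simp
  then have "tball L r x \<subseteq> tball L (mu * r) x" by (auto simp: tball_def)
  \<comment> \<open>Since the annulus is empty, deleting the large ball is the same as deleting the
    small one.\<close>
  then have E2: "?E2 = E - tball L r x \<times> UNIV" and split: "E = sym_diff ?E1 ?E2"
    using sepx by blast+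
  have "\<not> decoding_fails L nx C F ?E2"
  proof (rule insert.IH)
    show "U \<subseteq> sites L" "?E2 \<subseteq> qubits L ne" using insert.prems by auto
    show "?E2 \<inter> (tball L (mu * r) y - tball L r y) \<times> UNIV = {}" if "y \<in> U" for y
      using insert.prems(3)[of y] that by blast
    have "?E2 - (\<Union>x\<in>U. tball L r x) \<times> UNIV = E - (\<Union>x\<in>insert x U. tball L r x) \<times> UNIV"
      unfolding E2 by blast
    then show "\<not> decoding_fails L nx C F (?E2 - (\<Union>x\<in>U. tball L r x) \<times> UNIV)"
      using insert.prems(4) by simp
  qed
  moreover have "\<not> decoding_fails L nx C F ?E1"
  proof (rule small_cluster_corrected[OF L lam r x _ dec q ero dist])
    show "?E1 \<subseteq> tball L r x \<times> {1..ne}" using EQ by (auto simp: qubits_def)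
  qed
  moreover have "net_correction L C F E =
      sym_diff (net_correction L C F ?E1) (net_correction L C F ?E2)"
    using dcp r x EQ sepx unfolding cluster_decoupling_def by blast
  \<comment> \<open>Adding the error to both sides of the decoupling identity shows that residual
    errors add up, so closure of the stabilizers under addition applies.\<close>
  then have "sym_diff (net_correction L C F E) E =
      sym_diff (sym_diff (net_correction L C F ?E1) ?E1) (sym_diff (net_correction L C F ?E2) ?E2)"
    using split by blast
  ultimately show ?case
    unfolding decoding_fails_def using x_stabilizers_sym_diff by metis
qed



section \<open>Sparsity of the noise\<close>

text \<open>A cluster is represented by one of its errors as center instead of by its diameter.
  Hence an error that is not isolated directly yields a second error at distance between
  \<open>s\<close> and \<open>t\<close>, which is the branching step of the trees.\<close>

definition isolated :: "nat \<Rightarrow> real \<Rightarrow> real \<Rightarrow> 'd::finite qubit set \<Rightarrow> 'd qubit set" where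
  "isolated L s t M =
     {u \<in> M. \<forall>v\<in>M. real (tdist L (fst u) (fst v)) \<le> t \<longrightarrow> real (tdist L (fst u) (fst v)) \<le> s}"

text \<open>At level \<open>k\<close> only clusters around a center \<open>u\<close> are removed: the errors within distance
  \<open>scale_w \<beta> n k / 2 = \<beta> n ^ k\<close> of \<open>u\<close>, provided that there are no others within distance
  \<open>scale_w \<beta> n k / 2 + scale_b \<beta> \<gamma> n k = \<gamma> n ^ (k + 1)\<close>.\<close>

fun survivors :: "nat \<Rightarrow> real \<Rightarrow> real \<Rightarrow> nat \<Rightarrow> 'd::finite qubit set \<Rightarrow> nat \<Rightarrow> 'd qubit set" where
  "survivors L \<beta> \<gamma> n N 0 = N"
| "survivors L \<beta> \<gamma> n N (Suc k) =
     survivors L \<beta> \<gamma> n N k -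
     (\<Union>u\<in>isolated L (\<beta> * real n ^ k) (\<gamma> * real n ^ Suc k) (survivors L \<beta> \<gamma> n N k).
        tball L (scale_w \<beta> n k) (fst u)) \<times> UNIV"

lemma survivors_subset: "survivors L \<beta> \<gamma> n N k \<subseteq> N"
  by (induction k) auto

text \<open>The binary trees that witness survival: the two subtrees of a tree of depth \<open>k + 1\<close> are rooted
  at survivors of level \<open>k\<close>, which are so far apart that the subtrees are disjoint.\<close>

fun trees :: "nat \<Rightarrow> nat \<Rightarrow> real \<Rightarrow> nat \<Rightarrow> nat \<Rightarrow> 'd::finite qubit \<Rightarrow> 'd qubit set set" where
  "trees L ne \<gamma> n 0 u = {{u}}"
| "trees L ne \<gamma> n (Suc k) u =
     (\<Union>v\<in>tball L (\<gamma> * real n ^ Suc k) (fst u) \<times> {1..ne}.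
        (\<lambda>(A, B). A \<union> B) ` {(A, B) \<in> trees L ne \<gamma> n k u \<times> trees L ne \<gamma> n k v. A \<inter> B = {}})"

lemma card_mem_trees: "A \<in> trees L ne \<gamma> n k u \<Longrightarrow> finite A \<and> card A = 2 ^ k"
proof (induction k arbitrary: A u)
  case 0
  then show ?case by simp
next
  case (Suc k)
  from Suc.prems obtain v B B' where A: "A = B \<union> B'" "B \<inter> B' = {}"
      "B \<in> trees L ne \<gamma> n k u" "B' \<in> trees L ne \<gamma> n k v"
    by (auto simp del: power_Suc)
  then have "finite B" "card B = 2 ^ k" "finite B'" "card B' = 2 ^ k"
    using Suc.IH by simp_all
  with A(1,2) show ?case by (simp add: card_Un_disjoint)
qed

text \<open>A survivor \<open>u\<close> of level \<open>k + 1\<close> is not isolated at level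
  \<open>k\<close>, which gives a second survivor \<open>v\<close> at distance more than
  \<open>\<beta> * n ^ k\<close>. Both trees stay within half that distance of their roots, hence
  are disjoint. The hypothesis on \<open>\<gamma>\<close> says that the union again stays within
  \<open>\<beta> * n ^ (k + 1) / 2\<close> of \<open>u\<close>.\<close>

lemma ex_tree_if_survives:
  assumes L: "L \<ge> 1" and N: "N \<subseteq> qubits L ne" and \<beta>: "\<beta> > 0"
    and \<gamma>: "2 * \<gamma> * real n \<le> \<beta> * (real n - 1)"
    and u: "u \<in> survivors L \<beta> \<gamma> n N k"
  shows "\<exists>A\<in>trees L ne \<gamma> n k u. A \<subseteq> N \<and>
    (\<forall>v\<in>A. 2 * real (tdist L (fst u) (fst v)) \<le> \<beta> * real n ^ k)"
  using u
proof (induction k arbitrary: u)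
  case 0
  then show ?case using \<beta> by simp
next
  case (Suc k)
  let ?M = "survivors L \<beta> \<gamma> n N k"
  let ?I = "isolated L (\<beta> * real n ^ k) (\<gamma> * real n ^ Suc k) ?M"
  let ?d = "\<lambda>u v. real (tdist L (fst u) (fst v))"
  have tri: "?d x z \<le> ?d x y + ?d y z" for x y z :: "'a qubit"
    using tdist_triangle[OF L, of "fst x" "fst z" "fst y"] by linarith
  have M: "?M \<subseteq> qubits L ne" using survivors_subset N by blast
  have uM: "u \<in> ?M" using Suc.prems by simp
  then have ball: "fst u \<in> tball L (scale_w \<beta> n k) (fst u)"
    using M \<beta> by (auto simp: tball_def qubits_def scale_w_def)
  \<comment> \<open>An isolated \<open>u\<close> lies in its own ball and would have been
    deleted.\<close>
  have "u \<notin> ?I"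
  proof
    assume "u \<in> ?I"
    with ball have "u \<in> (\<Union>v\<in>?I. tball L (scale_w \<beta> n k) (fst v)) \<times> UNIV"
      unfolding mem_Times_iff by blast
    with Suc.prems show False by (simp del: power_Suc)
  qed
  then obtain v where v: "v \<in> ?M" "?d u v \<le> \<gamma> * real n ^ Suc k" "?d u v > \<beta> * real n ^ k"
    using uM unfolding isolated_def by (auto simp: not_le simp del: power_Suc)
  obtain A where A: "A \<in> trees L ne \<gamma> n k u" "A \<subseteq> N" "\<forall>z\<in>A. 2 * ?d u z \<le> \<beta> * real n ^ k"
    using Suc.IH[OF uM] by blast
  obtain B where B: "B \<in> trees L ne \<gamma> n k v" "B \<subseteq> N" "\<forall>z\<in>B. 2 * ?d v z \<le> \<beta> * real n ^ k"
    using Suc.IH[OF v(1)] by blast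
  have "A \<inter> B = {}"
  proof (rule ccontr)
    assume "A \<inter> B \<noteq> {}"
    then obtain z where "z \<in> A" "z \<in> B" by blast
    then have "2 * ?d u z \<le> \<beta> * real n ^ k" "2 * ?d z v \<le> \<beta> * real n ^ k"
      using A(3) B(3) tdist_commute[of L "fst z" "fst v"] by auto
    then show False using v(3) tri[of u v z] by linarith
  qed
  moreover have "v \<in> tball L (\<gamma> * real n ^ Suc k) (fst u) \<times> {1..ne}"
    using v(1,2) M by (auto simp: tball_def qubits_def mem_Times_iff)
  ultimately have "A \<union> B \<in> trees L ne \<gamma> n (Suc k) u"
    using A(1) B(1) unfolding trees.simps by (intro UN_I[of v] image_eqI[of _ _ "(A, B)"]) simp_all
  moreover have "2 * ?d u z \<le> \<beta> * real n ^ Suc k" if "z \<in> A \<union> B" for z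
  proof -
    \<comment> \<open>The distance to \<open>v\<close> forces this sign; it lets one bound cover
      both subtrees.\<close>
    have "0 \<le> \<gamma> * real n ^ Suc k" by (rule order_trans[OF of_nat_0_le_iff v(2)])
    moreover have "2 * ?d u z \<le> \<beta> * real n ^ k \<or> 2 * ?d v z \<le> \<beta> * real n ^ k"
      using that A(3) B(3) by blast
    ultimately have "2 * ?d u z \<le> 2 * (\<gamma> * real n ^ Suc k) + \<beta> * real n ^ k"
      using v(2) tri[of u z v] by linarith
    also have "\<dots> = (2 * \<gamma> * real n + \<beta>) * real n ^ k" by (simp add: algebra_simps)
    also have "\<dots> \<le> (\<beta> * real n) * real n ^ k"
      using \<gamma> by (intro mult_right_mono) (auto simp: algebra_simps)
    finally show ?thesis by (simp add: mult.assoc)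
  qed
  moreover have "A \<union> B \<subseteq> N" using A(2) B(2) by simp
  ultimately show ?case by (intro bexI[of _ "A \<union> B"] conjI ballI)
qed

section \<open>Counting the witness trees\<close>

text \<open>With \<open>D\<close> the dimension, the choices for \<open>v\<close> at depth
  \<open>k + 1\<close> number at most \<open>branching * (n ^ D) ^ k\<close>. The summand in
  \<open>ne + 1\<close> keeps the value positive for \<open>ne = 0\<close>, since it is used as a
  divisor.\<close>

definition branching :: "nat \<Rightarrow> real \<Rightarrow> nat \<Rightarrow> nat \<Rightarrow> real" where
  "branching ne \<gamma> n D = (real ne + 1) * ((2 * \<gamma> + 1) * real n) ^ D"

lemma branching_ge_1: "\<gamma> \<ge> 0 \<Longrightarrow> n \<ge> 1 \<Longrightarrow> branching ne \<gamma> n D \<ge> 1"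
proof -
  assume "\<gamma> \<ge> 0" "n \<ge> 1"
  then have "1 * 1 \<le> (2 * \<gamma> + 1) * real n" by (intro mult_mono) auto
  then have "1 * 1 \<le> (real ne + 1) * ((2 * \<gamma> + 1) * real n) ^ D"
    by (intro mult_mono one_le_power) auto
  then show ?thesis by (simp add: branching_def)
qed

text \<open>The ball volumes grow like \<open>G H ^ k\<close>; dividing by \<open>G H ^ (k + 1)\<close> makes the recursion
  \<open>T (k + 1) \<le> G H ^ k (T k)\<^sup>2\<close> reproduce the bound.\<close>

lemma card_trees_aux:
  fixes u :: "'d::finite qubit" and n ne :: nat and \<gamma> :: real
  defines "H \<equiv> real n ^ CARD('d)" and "G \<equiv> branching ne \<gamma> n CARD('d)"
  assumes L: "L \<ge> 1" and \<gamma>: "\<gamma> \<ge> 0" and n: "n \<ge> 1"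
  shows "finite (trees L ne \<gamma> n k u) \<and>
    real (card (trees L ne \<gamma> n k u)) \<le> (G * H) ^ 2 ^ k / (G * H ^ Suc k)"
proof (induction k arbitrary: u)
  have H: "H \<ge> 1" using n by (simp add: H_def)
  have G: "G \<ge> 1" using branching_ge_1[OF \<gamma> n] by (simp add: G_def)
  {
    case 0
    then show ?case using G H by simp
  next
    case (Suc k)
    let ?V = "tball L (\<gamma> * real n ^ Suc k) (fst u) \<times> {1..ne}"
    let ?T = "\<lambda>v. {(A, B) \<in> trees L ne \<gamma> n k u \<times> trees L ne \<gamma> n k v. A \<inter> B = {}}"
    let ?Q = "(G * H) ^ 2 ^ k / (G * H ^ Suc k)"
    have nn: "\<gamma> * real n ^ Suc k \<ge> 0" using \<gamma> by simp
    have finV: "finite ?V" using card_tball(1)[OF L nn] by blast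
    have sub: "?T v \<subseteq> trees L ne \<gamma> n k u \<times> trees L ne \<gamma> n k v" for v :: "'d qubit"
      by auto
    have finP: "finite (trees L ne \<gamma> n k u \<times> trees L ne \<gamma> n k v)" for v :: "'d qubit"
      by (intro finite_cartesian_product conjunct1[OF Suc])
    have finT: "finite (?T v)" for v :: "'d qubit" using sub finP by (rule finite_subset)
    have Q0: "?Q \<ge> 0" using G H by simp
    have cardT: "real (card ((\<lambda>(A, B). A \<union> B) ` ?T v)) \<le> ?Q * ?Q" for v :: "'d qubit"
    proof -
      \<comment> \<open>For an upper bound, disjointness and coinciding unions are ignored.\<close>
      have "card ((\<lambda>(A, B). A \<union> B) ` ?T v) \<le> card (trees L ne \<gamma> n k u \<times> trees L ne \<gamma> n k v)"
        by (rule order_trans[OF card_image_le[OF finT] card_mono[OF finP sub]])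
      then have "real (card ((\<lambda>(A, B). A \<union> B) ` ?T v)) \<le>
          real (card (trees L ne \<gamma> n k u)) * real (card (trees L ne \<gamma> n k v))"
        by (simp only: card_cartesian_product of_nat_mult[symmetric] of_nat_le_iff)
      also have "\<dots> \<le> ?Q * ?Q" using Q0 by (intro mult_mono conjunct2[OF Suc]) auto
      finally show ?thesis .
    qed
    have "real (card ?V) \<le> G * H ^ k"
    proof -
      \<comment> \<open>This absorbs the additive 1 of the ball volume into the power of
        \<open>n\<close>.\<close>
      have n1: "1 \<le> real n ^ Suc k" using n by (intro one_le_power) simp
      have "2 * (\<gamma> * real n ^ Suc k) + 1 \<le> (2 * \<gamma> + 1) * real n ^ Suc k"
        using n1 by (simp only: distrib_right mult.assoc mult_1)
      also have "\<dots> = (2 * \<gamma> + 1) * real n * real n ^ k" by simp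
      finally have "(2 * (\<gamma> * real n ^ Suc k) + 1) ^ CARD('d) \<le>
          ((2 * \<gamma> + 1) * real n * real n ^ k) ^ CARD('d)"
        using nn by (intro power_mono) linarith+
      also have "\<dots> = ((2 * \<gamma> + 1) * real n) ^ CARD('d) * H ^ k"
        by (simp add: H_def power_mult_distrib power_mult[symmetric] mult.commute)
      finally have "real (card (tball L (\<gamma> * real n ^ Suc k) (fst u))) \<le>
          ((2 * \<gamma> + 1) * real n) ^ CARD('d) * H ^ k"
        using card_tball(2)[OF L nn, of "fst u"] by linarith
      then have "real (card (tball L (\<gamma> * real n ^ Suc k) (fst u))) * real ne \<le>
          (((2 * \<gamma> + 1) * real n) ^ CARD('d) * H ^ k) * (real ne + 1)"
        using \<gamma> H by (intro mult_mono) auto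
      then show ?thesis
        by (simp add: card_cartesian_product G_def branching_def mult_ac)
    qed
    then have "real (card ?V) * (?Q * ?Q) \<le> (G * H ^ k) * (?Q * ?Q)"
      using Q0 by (intro mult_right_mono) auto
    also have "\<dots> = (G * H) ^ 2 ^ Suc k / (G * H ^ Suc (Suc k))"
    proof -
      \<comment> \<open>Here \<open>h\<close> stands for \<open>H ^ k\<close>: squaring the divisor
        \<open>G * H ^ (k + 1)\<close> and cancelling \<open>G * H ^ k\<close> leaves the next
        divisor \<open>G * H ^ (k + 2)\<close>.\<close>
      have "g * h * (z / (g * (H * h)) * (z / (g * (H * h)))) = z * z / (g * (H * (H * h)))"
        if "g > 0" "h > 0" for g h z
        using that H by (simp add: field_simps)
      from this[of G "H ^ k" "(G * H) ^ 2 ^ k"] G H show ?thesis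
        by (simp add: mult_2 power_add)
    qed
    finally have bound: "real (card ?V) * (?Q * ?Q) \<le> (G * H) ^ 2 ^ Suc k / (G * H ^ Suc (Suc k))" .
    have "card (trees L ne \<gamma> n (Suc k) u) \<le> (\<Sum>v\<in>?V. card ((\<lambda>(A, B). A \<union> B) ` ?T v))"
      unfolding trees.simps by (rule card_UN_le[OF finV])
    then have "real (card (trees L ne \<gamma> n (Suc k) u)) \<le>
        (\<Sum>v\<in>?V. real (card ((\<lambda>(A, B). A \<union> B) ` ?T v)))"
      by (simp only: of_nat_sum[symmetric] of_nat_le_iff)
    also have "\<dots> \<le> real (card ?V) * (?Q * ?Q)"
      using cardT by (intro sum_bounded_above) auto
    finally have "real (card (trees L ne \<gamma> n (Suc k) u)) \<le> real (card ?V) * (?Q * ?Q)" .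
    moreover have "finite (trees L ne \<gamma> n (Suc k) u)"
      unfolding trees.simps using finV finT by blast
    ultimately show ?case using bound by linarith
  }
qed

lemma card_trees:
  fixes u :: "'d::finite qubit"
  assumes "L \<ge> 1" "\<gamma> \<ge> 0" "n \<ge> 1"
  shows "finite (trees L ne \<gamma> n k u)"
    "real (card (trees L ne \<gamma> n k u)) \<le>
       (branching ne \<gamma> n CARD('d) * real n ^ CARD('d)) ^ 2 ^ k"
proof -
  let ?G = "branching ne \<gamma> n CARD('d)" and ?H = "real n ^ CARD('d)"
  note aux = card_trees_aux[OF assms, where u = u and k = k and ne = ne]
  show "finite (trees L ne \<gamma> n k u)" using aux by blast
  have GH: "1 \<le> ?G" "1 \<le> ?H" using branching_ge_1[OF assms(2,3)] assms(3) by simp_all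
  then have "1 * 1 \<le> ?G * ?H ^ Suc k" using assms(3) by (intro mult_mono one_le_power) auto
  then have "(?G * ?H) ^ 2 ^ k / (?G * ?H ^ Suc k) \<le> (?G * ?H) ^ 2 ^ k / 1"
    using GH assms(3) by (intro divide_left_mono) auto
  then show "real (card (trees L ne \<gamma> n k u)) \<le> (?G * ?H) ^ 2 ^ k" using aux by simp
qed

text \<open>Two union bounds, over the trees of a fixed root and then over the roots. Each tree has
  exactly \<open>2 ^ k\<close> errors, which gives the doubly exponential decay.\<close>

lemma prob_survivors:
  fixes \<nu> :: "'d::finite qubit set pmf"
  assumes L: "L \<ge> 1" and \<beta>: "\<beta> > 0" and \<gamma>0: "\<gamma> \<ge> 0" and n: "n \<ge> 1"
    and \<gamma>: "2 * \<gamma> * real n \<le> \<beta> * (real n - 1)"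
    and p: "p \<ge> 0" and \<nu>: "p_bounded_noise L ne p \<nu>"
  shows "measure_pmf.prob \<nu> {N. survivors L \<beta> \<gamma> n N k \<noteq> {}} \<le>
    real (L ^ CARD('d) * ne) * (branching ne \<gamma> n CARD('d) * real n ^ CARD('d) * p) ^ 2 ^ k"
proof -
  let ?Q = "branching ne \<gamma> n CARD('d) * real n ^ CARD('d)"
  let ?T = "trees L ne \<gamma> n k :: 'd qubit \<Rightarrow> _"
  have nu1: "set_pmf \<nu> \<subseteq> Pow (qubits L ne)"
    and nu2: "\<And>A. A \<subseteq> qubits L ne \<Longrightarrow> measure_pmf.prob \<nu> {N. A \<subseteq> N} \<le> p ^ card A"
    using \<nu> by (auto simp: p_bounded_noise_def)
  have tree: "measure_pmf.prob \<nu> {N. A \<subseteq> N} \<le> p ^ 2 ^ k" if "A \<in> ?T u" for A u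
  \<comment> \<open>The root \<open>u\<close> is arbitrary here; a tree that leaves the set of
    qubits has probability 0.\<close>
  proof (cases "A \<subseteq> qubits L ne")
    case True
    then show ?thesis using nu2 card_mem_trees[OF that] by metis
  next
    case False
    then have "set_pmf \<nu> \<inter> {N. A \<subseteq> N} = {}" using nu1 by blast
    then have "measure_pmf.prob \<nu> {N. A \<subseteq> N} = 0" by (simp add: measure_pmf_zero_iff)
    then show ?thesis using p by simp
  qed
  have root: "measure_pmf.prob \<nu> (\<Union>A\<in>?T u. {N. A \<subseteq> N}) \<le> (?Q * p) ^ 2 ^ k" for u
  proof -
    have fin: "finite (?T u)" by (rule card_trees(1)[OF L \<gamma>0 n])
    have "measure_pmf.prob \<nu> (\<Union>A\<in>?T u. {N. A \<subseteq> N}) \<le>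
        (\<Sum>A\<in>?T u. measure_pmf.prob \<nu> {N. A \<subseteq> N})"
      by (rule measure_pmf.finite_measure_subadditive_finite[OF fin]) simp
    also have "\<dots> \<le> real (card (?T u)) * p ^ 2 ^ k"
      using tree by (intro sum_bounded_above) auto
    also have "\<dots> \<le> ?Q ^ 2 ^ k * p ^ 2 ^ k"
      using card_trees(2)[OF L \<gamma>0 n, of ne k u] p by (intro mult_right_mono) auto
    finally show ?thesis by (simp add: power_mult_distrib)
  qed
  \<comment> \<open>Witness trees exist for noise made of qubits, so the event is first restricted
    to the support of \<open>\<nu>\<close>.\<close>
  have "measure_pmf.prob \<nu> {N. survivors L \<beta> \<gamma> n N k \<noteq> {}} =
      measure_pmf.prob \<nu> ({N. survivors L \<beta> \<gamma> n N k \<noteq> {}} \<inter> set_pmf \<nu>)"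
    by (simp add: measure_Int_set_pmf)
  also have "\<dots> \<le> measure_pmf.prob \<nu> (\<Union>u\<in>qubits L ne. \<Union>A\<in>?T u. {N. A \<subseteq> N})"
  proof (rule measure_pmf.finite_measure_mono)
    show "{N. survivors L \<beta> \<gamma> n N k \<noteq> {}} \<inter> set_pmf \<nu> \<subseteq>
        (\<Union>u\<in>qubits L ne. \<Union>A\<in>?T u. {N. A \<subseteq> N})"
    proof
      fix N assume N: "N \<in> {N. survivors L \<beta> \<gamma> n N k \<noteq> {}} \<inter> set_pmf \<nu>"
      then have sub: "N \<subseteq> qubits L ne" using nu1 by blast
      from N obtain u where u: "u \<in> survivors L \<beta> \<gamma> n N k" by blast
      then have "u \<in> qubits L ne" using sub survivors_subset by blast
      then show "N \<in> (\<Union>u\<in>qubits L ne. \<Union>A\<in>?T u. {N. A \<subseteq> N})"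
        using ex_tree_if_survives[OF L sub \<beta> \<gamma> u] by blast
    qed
  qed simp
  also have "\<dots> \<le> (\<Sum>u\<in>qubits L ne. measure_pmf.prob \<nu> (\<Union>A\<in>?T u. {N. A \<subseteq> N}))"
    by (rule measure_pmf.finite_measure_subadditive_finite[OF finite_qubits]) simp
  also have "\<dots> \<le> real (card (qubits L ne :: 'd qubit set)) * (?Q * p) ^ 2 ^ k"
    using root by (intro sum_bounded_above) auto
  finally show ?thesis by (simp add: card_qubits)
qed

section \<open>From sparse noise to successful decoding\<close>

text \<open>Descending induction on the level: going from the survivors of level
  \<open>k + 1\<close> back to those of level \<open>k\<close> restores isolated clusters, which
  \<open>remove_clusters\<close> shows to be harmless.\<close>

lemma no_failure_if_no_survivors:
  fixes C :: "'d::finite code"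
  assumes L: "L \<ge> 1" and lam: "lam \<ge> 1" and mu: "mu \<ge> 1"
    and dec: "ca_decoder L ne nm q R d1 C F" and q: "q \<ge> 1"
    and ero: "linear_cluster_erosion L ne lam C F"
    and dcp: "cluster_decoupling L ne mu C F"
    and scales: "admissible_scales \<beta> \<gamma> n mu"
    and K: "K \<ge> 1" and dist: "\<forall>k<K. ereal (2 * lam * scale_w \<beta> n k) < x_distance L ne nx C"
    and N: "N \<subseteq> qubits L ne" and none: "survivors L \<beta> \<gamma> n N K = {}"
  shows "\<not> decoding_fails L nx C F N"
proof -
  have \<beta>: "\<beta> > 0" and n: "n \<ge> 2" and w0: "scale_w \<beta> n 0 \<ge> 1"
    and b: "\<And>k. scale_b \<beta> \<gamma> n k \<ge> (1 + mu) * scale_w \<beta> n k"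
    using scales by (auto simp: admissible_scales_def)
  have w: "scale_w \<beta> n k \<ge> 1" for k
  proof -
    have "1 * 1 \<le> scale_w \<beta> n 0 * real n ^ k"
      using w0 n by (intro mult_mono one_le_power) auto
    then show ?thesis by (simp add: scale_w_def)
  qed
  obtain x0 :: "'d site" where x0: "x0 \<in> sites L"
    using L by (auto simp: sites_def intro!: that[of "\<lambda>_. 0"])
  \<comment> \<open>The empty error counts as a cluster at scale \<open>w_0\<close>;
    \<open>K \<ge> 1\<close> supplies the distance bound at that scale.\<close>
  have empty: "\<not> decoding_fails L nx C F {}"
    using small_cluster_corrected[OF L lam w0 x0 _ dec q ero] dist K by auto
  have "\<not> decoding_fails L nx C F (survivors L \<beta> \<gamma> n N (K - j))" if "j \<le> K" for j
    using that
  proof (induction j)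
    case 0
    then show ?case using none empty by simp
  next
    case (Suc j)
    define k where "k = K - Suc j"
    have k: "K - j = Suc k" "k < K" using Suc.prems by (auto simp: k_def)
    let ?M = "survivors L \<beta> \<gamma> n N k"
    let ?I = "isolated L (\<beta> * real n ^ k) (\<gamma> * real n ^ Suc k) ?M"
    have M: "?M \<subseteq> qubits L ne" using N survivors_subset by blast
    have I: "?I \<subseteq> qubits L ne" using M by (auto simp: isolated_def)
    have "\<not> decoding_fails L nx C F ?M"
    proof (rule remove_clusters[OF L lam mu w dec q ero dcp])
      show "ereal (2 * lam * scale_w \<beta> n k) < x_distance L ne nx C" using dist k by blast
      show "finite (fst ` ?I)" using I finite_qubits finite_subset by blast
      show "fst ` ?I \<subseteq> sites L" using I by (auto simp: qubits_def)
      show "?M \<subseteq> qubits L ne" by (rule M)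
      \<comment> \<open>The annulus between \<open>scale_w\<close> and \<open>mu * scale_w\<close>
        required by decoupling thus lies inside the one that isolation keeps empty.\<close>
      have "mu * scale_w \<beta> n k \<le> \<gamma> * real n ^ Suc k"
      proof -
        have "mu * scale_w \<beta> n k \<le> scale_b \<beta> \<gamma> n k" using b[of k] w[of k] by (simp add: distrib_right)
        also have "\<dots> \<le> \<gamma> * real n ^ Suc k" using \<beta> by (simp add: scale_b_def algebra_simps)
        finally show ?thesis .
      qed
      moreover have "\<beta> * real n ^ k \<le> scale_w \<beta> n k" using \<beta> by (simp add: scale_w_def)
      ultimately show "?M \<inter> (tball L (mu * scale_w \<beta> n k) x - tball L (scale_w \<beta> n k) x) \<times> UNIV = {}"
        if "x \<in> fst ` ?I" for x
        using that by (fastforce simp: isolated_def tball_def simp del: power_Suc)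
      have "\<not> decoding_fails L nx C F (survivors L \<beta> \<gamma> n N (Suc k))"
        using Suc.IH Suc.prems k by simp
      then show "\<not> decoding_fails L nx C F
          (?M - (\<Union>x\<in>fst ` ?I. tball L (scale_w \<beta> n k) x) \<times> UNIV)"
        by (simp add: image_image)
    qed
    then show ?case by (simp add: k_def)
  qed
  from this[of K] show ?thesis by simp
qed


section \<open>Scaling with the system size\<close>

text \<open>The scale condition amounts to \<open>n ^ k < c * L\<close>, so \<open>K\<close> can be
  the logarithm of \<open>c * L\<close> to base \<open>n\<close>, rounded down. Giving up half of
  the logarithm of \<open>L\<close> pays for \<open>c\<close> and for the rounding.\<close>

lemma ex_level:
  assumes lam: "lam \<ge> 1" and \<beta>: "\<beta> > 0" and n: "n \<ge> 2" and \<delta>: "\<delta> > 0"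
  shows "\<forall>\<^sub>F L in sequentially. \<exists>K\<ge>1. ln (real L) / (2 * ln (real n)) \<le> real K \<and>
    (\<forall>k<K. 2 * lam * scale_w \<beta> n k < \<delta> * real L)"
proof -
  define c where "c = \<delta> / (4 * lam * \<beta>)"
  have c: "c > 0" using assms by (simp add: c_def)
  have lnn: "ln (real n) > 0" using n by simp
  \<comment> \<open>The first bound is \<open>ln L / (2 * ln n) \<le> X - 1\<close> solved for
    \<open>ln L\<close>; the second excludes \<open>L = 0\<close>, as
    \<open>ln 0 = 0\<close>.\<close>
  have "\<forall>\<^sub>F L in sequentially. 2 * (ln (real n) - ln c) \<le> ln (real L) \<and> 0 < ln (real L)"
    by (intro eventually_conj) real_asymp+
  then show ?thesis
  proof eventually_elim
    case (elim L)
    have L0: "real L > 0" using elim by (cases "L = 0") auto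
    define X where "X = (ln (real L) + ln c) / ln (real n)"
    define K where "K = nat \<lfloor>X\<rfloor>"
    have "ln (real L) / (2 * ln (real n)) \<le> X - 1"
      using elim lnn by (simp add: X_def field_simps)
    then have K: "ln (real L) / (2 * ln (real n)) \<le> real K" unfolding K_def by linarith
    have "0 < ln (real L) / (2 * ln (real n))" using elim lnn by simp
    then have K1: "K \<ge> 1" "X > 0" using K \<open>_ \<le> X - 1\<close> by linarith+
    have "real n ^ K = real n powr real K" using n by (simp add: powr_realpow)
    also have "\<dots> \<le> real n powr X" using n K1(2) by (intro powr_mono) (auto simp: K_def)
    also have "\<dots> = real L * c" using n L0 c lnn by (simp add: powr_def X_def exp_add)
    finally have nK: "real n ^ K \<le> real L * c" .
    have "2 * lam * scale_w \<beta> n k < \<delta> * real L" if "k < K" for k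
    proof -
      have "real n ^ k < real n ^ K" using that n by (intro power_strict_increasing) auto
      with nK have "4 * lam * \<beta> * real n ^ k < 4 * lam * \<beta> * (real L * c)"
        using lam \<beta> by (intro mult_strict_left_mono) auto
      then show ?thesis using lam \<beta> by (simp add: scale_w_def c_def mult_ac)
    qed
    with K K1(1) show ?case by blast
  qed
qed

lemma max_scale_ge:
  assumes "\<forall>k<K. ereal (2 * lam * scale_w \<beta> n k) < dX"
  shows "ereal (real K) \<le> ereal_of_enat (max_scale \<beta> n lam dX)"
proof -
  have "enat K \<le> max_scale \<beta> n lam dX"
    unfolding max_scale_def using assms by (intro Sup_upper) auto
  then have "ereal_of_enat (enat K) \<le> ereal_of_enat (max_scale \<beta> n lam dX)"
    by (simp only: ereal_of_enat_le_iff)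
  then show ?thesis by simp
qed

text \<open>A threshold of \<open>1 / (2 * Q)\<close> rather than \<open>1 / Q\<close> leaves a
  spare factor \<open>1 / 2 ^ 2 ^ K\<close>, which cancels the volume \<open>V\<close>. The
  remaining base is below 1, so lowering its exponent to \<open>x\<close> only weakens the
  bound.\<close>

lemma volume_absorbed:
  fixes V \<alpha> Q p :: real
  assumes Q: "Q > 0" and p: "0 \<le> p" "p < 1 / (2 * Q)"
    and V: "V \<le> 2 powr x" and x: "x > 0" "x \<le> 2 ^ K" and V0: "V \<ge> 0"
  shows "V * (Q * p) ^ 2 ^ K \<le> (p / (1 / (2 * Q))) powr x"
\<comment> \<open>\<open>powr_realpow\<close> needs a positive base; for \<open>p = 0\<close> both
  sides vanish.\<close>
proof (cases "p = 0")
  case True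
  then show ?thesis by (simp add: power_0_left)
next
  case False
  define z where "z = 2 * Q * p"
  have z: "0 < z" "z < 1" using Q p False by (auto simp: z_def field_simps)
  have "V * (Q * p) ^ 2 ^ K = V / 2 ^ 2 ^ K * z ^ 2 ^ K"
    by (simp add: z_def power_mult_distrib)
  also have "\<dots> \<le> 1 * z ^ 2 ^ K"
  proof (rule mult_right_mono)
    have "V \<le> 2 powr (2 ^ K)" using V powr_mono[OF x(2), of "2::real"] by linarith
    also have "\<dots> = 2 powr real (2 ^ K)" by simp
    also have "\<dots> = 2 ^ 2 ^ K" by (rule powr_realpow) simp
    finally show "V / 2 ^ 2 ^ K \<le> 1" by simp
  qed (use z in auto)
  also have "\<dots> = z powr real (2 ^ K)" using z by (subst powr_realpow) auto
  also have "\<dots> \<le> z powr x" using x(2) z by (intro powr_mono') auto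
  finally show ?thesis by (simp add: z_def mult_ac)
qed

theorem theorem3p13:
  fixes sizes :: "nat set"
    and C :: "nat \<Rightarrow> 'd::finite code"
    and F :: "nat \<Rightarrow> 'd config \<Rightarrow> 'd config"
    and ne nx nm q n :: nat
    and d0 d1 R a b lam mu \<beta> \<gamma> \<delta> :: real
  assumes sizes: "\<forall>L\<in>sizes. L \<ge> 1"
    and constants: "d0 > 0" "d1 > 0" "R \<ge> 0" "q \<ge> 1" "a \<ge> 1" "b \<ge> 1" "lam \<ge> 1" "mu \<ge> 1"
    and code: "\<forall>L\<in>sizes. local_css_code L ne nx d0 (C L)"
    and decoder: "\<forall>L\<in>sizes. ca_decoder L ne nm q R d1 (C L) (F L)"
    and defect_erosion: "\<forall>L\<in>sizes. linear_defect_erosion L ne a (C L) (F L)"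
    and message_erosion: "\<forall>L\<in>sizes. linear_message_erosion L ne b (C L) (F L)"
    and cluster_erosion: "\<forall>L\<in>sizes. linear_cluster_erosion L ne lam (C L) (F L)"
    and decoupling: "\<forall>L\<in>sizes. cluster_decoupling L ne mu (C L) (F L)"
    and scales: "admissible_scales \<beta> \<gamma> n mu"
    and distance: "\<delta> > 0"
      "\<exists>L\<^sub>0. \<forall>L\<in>sizes. L \<ge> L\<^sub>0 \<longrightarrow> ereal (\<delta> * real L) \<le> x_distance L ne nx (C L)"
  shows "(\<exists>\<kappa>>0. \<exists>L\<^sub>0. \<forall>L\<in>sizes. L \<ge> L\<^sub>0 \<longrightarrow>
           ereal (\<kappa> * ln (real L)) \<le>
           ereal_of_enat (max_scale \<beta> n lam (x_distance L ne nx (C L)))) \<and>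
         (\<exists>\<alpha>>0. \<exists>p\<^sub>0>0. \<exists>c>0. \<exists>L\<^sub>0. \<forall>L\<in>sizes. L \<ge> L\<^sub>0 \<longrightarrow>
           (\<forall>p \<nu>. 0 \<le> p \<and> p < p\<^sub>0 \<and> p_bounded_noise L ne p \<nu> \<longrightarrow>
              measure_pmf.prob \<nu> {N. decoding_fails L nx (C L) (F L) N}
                \<le> (p / p\<^sub>0) powr (c * real L powr \<alpha>)))"
proof -
  have \<beta>: "\<beta> > 0" and \<gamma>: "\<gamma> > 0" and n: "n \<ge> 2" and "2 * \<gamma> / (1 - 1 / real n) < \<beta>"
    using scales by (auto simp: admissible_scales_def)
  then have gap: "2 * \<gamma> * real n \<le> \<beta> * (real n - 1)" by (simp add: field_simps)
  \<comment> \<open>\<open>\<kappa>\<close> is the rate from \<open>ex_level\<close>;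
    \<open>\<alpha>\<close> is chosen so that \<open>2 powr (\<kappa> * ln L)\<close> equals
    \<open>L powr \<alpha>\<close>.\<close>
  define \<kappa> where "\<kappa> = 1 / (2 * ln (real n))"
  define \<alpha> where "\<alpha> = \<kappa> * ln 2"
  have \<kappa>: "\<kappa> > 0" using n by (simp add: \<kappa>_def)
  then have \<alpha>: "\<alpha> > 0" by (simp add: \<alpha>_def)
  define Q where "Q = branching ne \<gamma> n CARD('d) * real n ^ CARD('d)"
  have "branching ne \<gamma> n CARD('d) \<ge> 1" using \<gamma> n by (intro branching_ge_1) auto
  then have Q: "Q > 0" using n by (simp add: Q_def)
  obtain L0 where L0: "\<And>L. L \<in> sizes \<Longrightarrow> L \<ge> L0 \<Longrightarrow>
      ereal (\<delta> * real L) \<le> x_distance L ne nx (C L)"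
    using distance(2) by blast
  obtain L1 where L1: "\<And>L. L \<ge> L1 \<Longrightarrow> \<exists>K\<ge>1. ln (real L) / (2 * ln (real n)) \<le> real K \<and>
      (\<forall>k<K. 2 * lam * scale_w \<beta> n k < \<delta> * real L)"
    using ex_level[OF constants(7) \<beta> n distance(1)] by (auto simp: eventually_sequentially)
  \<comment> \<open>The number of qubits is polynomial in \<open>L\<close>, hence eventually below
    an exponential of a power of \<open>L\<close>.\<close>
  have "\<forall>\<^sub>F L in sequentially. real L ^ CARD('d) * (real ne + 1) \<le> 2 powr (real L powr \<alpha>)"
    using \<alpha> by real_asymp
  then obtain L2 where L2: "\<And>L. L \<ge> L2 \<Longrightarrow>
      real L ^ CARD('d) * (real ne + 1) \<le> 2 powr (real L powr \<alpha>)"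
    by (auto simp: eventually_sequentially)
  have level: "\<exists>K\<ge>1. \<kappa> * ln (real L) \<le> real K \<and>
      (\<forall>k<K. ereal (2 * lam * scale_w \<beta> n k) < x_distance L ne nx (C L))"
    if L: "L \<in> sizes" "L \<ge> max L0 L1" for L
  proof -
    obtain K where K: "K \<ge> 1" "ln (real L) / (2 * ln (real n)) \<le> real K"
        "\<forall>k<K. 2 * lam * scale_w \<beta> n k < \<delta> * real L"
      using L1[of L] L by auto
    have "ereal (2 * lam * scale_w \<beta> n k) < x_distance L ne nx (C L)" if "k < K" for k
    proof -
      have "ereal (2 * lam * scale_w \<beta> n k) < ereal (\<delta> * real L)" using K(3) that by simp
      also have "\<dots> \<le> x_distance L ne nx (C L)" using L0 L by simp
      finally show ?thesis .
    qed
    with K(1,2) show ?thesis by (auto simp: \<kappa>_def)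
  qed
  have log_levels: "ereal (\<kappa> * ln (real L)) \<le>
      ereal_of_enat (max_scale \<beta> n lam (x_distance L ne nx (C L)))"
    if L: "L \<in> sizes" "L \<ge> max L0 L1" for L
  proof -
    obtain K :: nat where K: "\<kappa> * ln (real L) \<le> real K"
        "\<forall>k<K. ereal (2 * lam * scale_w \<beta> n k) < x_distance L ne nx (C L)"
      using level[OF L] by auto
    from K(1) have "ereal (\<kappa> * ln (real L)) \<le> ereal (real K)" by simp
    also note max_scale_ge[OF K(2)]
    finally show ?thesis .
  qed
  \<comment> \<open>The factor 1 in the exponent is the witness for \<open>c\<close>, and
    \<open>1 / (2 * Q)\<close> the one for the threshold.\<close>
  have fail: "measure_pmf.prob \<nu> {N. decoding_fails L nx (C L) (F L) N}
      \<le> (p / (1 / (2 * Q))) powr (1 * real L powr \<alpha>)"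
    if L: "L \<in> sizes" "L \<ge> max (max L0 L1) L2"
      and p: "0 \<le> p" "p < 1 / (2 * Q)" and \<nu>: "p_bounded_noise L ne p \<nu>" for L p \<nu>
  proof -
    have Lpos: "L \<ge> 1" using sizes L by blast
    obtain K where K: "K \<ge> 1" "\<kappa> * ln (real L) \<le> real K"
        "\<forall>k<K. ereal (2 * lam * scale_w \<beta> n k) < x_distance L ne nx (C L)"
      using level L by auto
    have nofail: "\<not> decoding_fails L nx (C L) (F L) N"
      if "N \<subseteq> qubits L ne" "survivors L \<beta> \<gamma> n N K = {}" for N
      using no_failure_if_no_survivors[OF Lpos constants(7,8) _ constants(4) _ _ scales K(1,3) that]
        decoder cluster_erosion decoupling L(1) by blast
    have "set_pmf \<nu> \<subseteq> Pow (qubits L ne)" using \<nu> by (simp add: p_bounded_noise_def)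
    then have "{N. decoding_fails L nx (C L) (F L) N} \<inter> set_pmf \<nu> \<subseteq>
        {N. survivors L \<beta> \<gamma> n N K \<noteq> {}}"
      using nofail by blast
    then have "measure_pmf.prob \<nu> ({N. decoding_fails L nx (C L) (F L) N} \<inter> set_pmf \<nu>) \<le>
        measure_pmf.prob \<nu> {N. survivors L \<beta> \<gamma> n N K \<noteq> {}}"
      by (intro measure_pmf.finite_measure_mono) auto
    then have "measure_pmf.prob \<nu> {N. decoding_fails L nx (C L) (F L) N} \<le>
        measure_pmf.prob \<nu> {N. survivors L \<beta> \<gamma> n N K \<noteq> {}}"
      by (simp add: measure_Int_set_pmf)
    also have "\<dots> \<le> real (L ^ CARD('d) * ne) * (Q * p) ^ 2 ^ K"
      using prob_survivors[OF Lpos \<beta> _ _ gap p(1) \<nu>] \<gamma> n by (simp add: Q_def)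
    also have "\<dots> \<le> (p / (1 / (2 * Q))) powr (real L powr \<alpha>)"
    proof (rule volume_absorbed[OF Q p])
      have "real (L ^ CARD('d) * ne) \<le> real L ^ CARD('d) * (real ne + 1)"
        by (simp add: distrib_left)
      also have "\<dots> \<le> 2 powr (real L powr \<alpha>)" using L2 L by simp
      finally show "real (L ^ CARD('d) * ne) \<le> 2 powr (real L powr \<alpha>)" .
      have "real L powr \<alpha> = 2 powr (\<kappa> * ln (real L))"
        using Lpos by (simp add: powr_def \<alpha>_def mult_ac)
      also have "\<dots> \<le> 2 powr real K" using K(2) by (intro powr_mono) auto
      also have "\<dots> = 2 ^ K" by (simp add: powr_realpow)
      finally show "real L powr \<alpha> \<le> 2 ^ K" .
    qed (use Lpos in auto)
    finally show ?thesis by simp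
  qed
  have "\<exists>L\<^sub>0. \<forall>L\<in>sizes. L \<ge> L\<^sub>0 \<longrightarrow> (\<forall>p \<nu>. 0 \<le> p \<and> p < 1 / (2 * Q) \<and> p_bounded_noise L ne p \<nu> \<longrightarrow>
      measure_pmf.prob \<nu> {N. decoding_fails L nx (C L) (F L) N}
        \<le> (p / (1 / (2 * Q))) powr (1 * real L powr \<alpha>))"
    using fail by blast
  moreover have "1 / (2 * Q) > 0" using Q by simp
  ultimately have "\<exists>\<alpha>>0. \<exists>p\<^sub>0>0. \<exists>c>0. \<exists>L\<^sub>0. \<forall>L\<in>sizes. L \<ge> L\<^sub>0 \<longrightarrow>
      (\<forall>p \<nu>. 0 \<le> p \<and> p < p\<^sub>0 \<and> p_bounded_noise L ne p \<nu> \<longrightarrow>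
        measure_pmf.prob \<nu> {N. decoding_fails L nx (C L) (F L) N}
          \<le> (p / p\<^sub>0) powr (c * real L powr \<alpha>))"
    using \<alpha> zero_less_one by blast
  moreover have "\<exists>\<kappa>>0. \<exists>L\<^sub>0. \<forall>L\<in>sizes. L \<ge> L\<^sub>0 \<longrightarrow>
      ereal (\<kappa> * ln (real L)) \<le>
      ereal_of_enat (max_scale \<beta> n lam (x_distance L ne nx (C L)))"
    using \<kappa> log_levels by blast
  ultimately show ?thesis by blast
qed

end
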